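(* Let $m,n\ge1$. The map $\phi:\mathsf{EW}_{m,n}\to\mathsf{LRib}_{m,n}$ described in the context is a bijection.
   Context: All tableaux are $0/1$ arrays; $T_{ij}$ denotes the entry in row $i$ (rows numbered top to bottom) and column $j$ (columns numbered left to right). Labels are symbols $v_0,v_1,\dots,v_{m+n-1}$, ordered by $v_i<v_j$ iff $i<j$. Rectangular EW-tableau: an $m\times n$ $0/1$ tableau $T$ such that (i) every entry of the top row is $1$; (ii) every other row contains at least one $0$; (iii) there are no rows $i\ne i'$ and columns $k\ne k'$ with $T_{ik}=T_{i'k'}=0$ and $T_{ik'}=T_{i'k}=1$. $\mathsf{EW}_{m,n}$ is the set of these. The rows of $T$ are labelled $v_0,\dots,v_{m-1}$ from top to bottom and the columns $v_m,\dots,v_{m+n-1}$ from left to right. Parallelogram polyomino of type $(m,n)$: an $m\times n$ $0/1$ tableau $P$ with $P_{11}=P_{mn}=1$, such that every row contains at least one $1$ and the $1$s in each row are contiguous, and for each $2\le i\le m$: the leftmost $1$ of row $i$ is weakly to the right of the leftmost $1$ of row $i-1$ and weakly to the left of the rightmost $1$ of row $i-1$, and the rightmost $1$ of row $i$ is weakly to the right of the rightmost $1$ of row $i-1$. It is a ribbon parallelogram polyomino if it has exactly $m+n-1$ entries equal to $1$. Labelled parallelogram polyomino of type $(m,n)$: a pair $(P,\ell)$ with $P$ a parallelogram polyomino of type $(m,n)$ and $\ell=(\ell(\mathrm{row}_1),\dots,\ell(\mathrm{row}_m),\ell(\mathrm{col}_1),\dots,\ell(\mathrm{col}_n))$, where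 the row labels are a permutation of $\{v_0,\dots,v_{m-1}\}$ with $\ell(\mathrm{row}_1)=v_0$ and such that the labels of rows whose leftmost $1$s lie in the same column are increasing from top to bottom, and the column labels are a permutation of $\{v_m,\dots,v_{m+n-1}\}$ such that the labels of columns whose topmost $1$s lie in the same row are increasing from left to right. $\mathsf{LRib}_{m,n}$ is the set of those with $P$ a ribbon parallelogram polyomino. The map $\phi$: given $T\in\mathsf{EW}_{m,n}$ with its labels, (1) permute the columns (carrying their labels) so that every entry to the left of a $0$ is a $0$, with identical columns placed so their labels increase from left to right; (2) then permute the rows (carrying labels) so that every entry above a $1$ is a $1$, with identical rows placed so their labels increase from top to bottom; call the result $T'$ and the resulting labelling $\ell$. (3) Let $R$ be the $m\times n$ tableau with $R_{ij}=1$ if either [$T'_{ij}=1$ and ($i=m$ or $T'_{i+1,j}=0$)] or [$T'_{ij}=0$ and ($j=n$ or $T'_{i,j+1}=1$)], and $R_{ij}=0$ otherwise. Set $\phi(T)=(R,\ell)$; this lies in $\mathsf{LRib}_{m,n}$. *)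

theory Defs
  imports Jordan_Normal_Form.Matrix
    "HOL-Combinatorics.List_Permutation"
    "HOL-Combinatorics.Multiset_Permutations"
begin

text \<open>
  Rows and columns are numbered from 0 (top to bottom, left to right), and the label
  \<open>v\<^sub>k\<close> is represented by the natural number \<open>k\<close>. So in an EW-tableau with \<open>m\<close> rows,
  row \<open>i\<close> carries the label \<open>i\<close> and column \<open>j\<close> the label \<open>m + j\<close>.
\<close>

definition tableaux :: "nat \<Rightarrow> nat \<Rightarrow> nat mat set" where
  "tableaux m n = {T \<in> carrier_mat m n. elements_mat T \<subseteq> {0, 1}}"

definition EW :: "nat \<Rightarrow> nat \<Rightarrow> nat mat set" where
  "EW m n = {T \<in> tableaux m n.
     (\<forall>j<n. T $$ (0, j) = 1) \<and>
     (\<forall>i<m. i \<noteq> 0 \<longrightarrow> (\<exists>j<n. T $$ (i, j) = 0)) \<and>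
     \<not> (\<exists>i<m. \<exists>i'<m. \<exists>k<n. \<exists>k'<n. i \<noteq> i' \<and> k \<noteq> k' \<and>
          T $$ (i, k) = 0 \<and> T $$ (i', k') = 0 \<and> T $$ (i, k') = 1 \<and> T $$ (i', k) = 1)}"

definition leftmost_one :: "nat mat \<Rightarrow> nat \<Rightarrow> nat" where
  "leftmost_one P i = Min {j. j < dim_col P \<and> P $$ (i, j) = 1}"

definition rightmost_one :: "nat mat \<Rightarrow> nat \<Rightarrow> nat" where
  "rightmost_one P i = Max {j. j < dim_col P \<and> P $$ (i, j) = 1}"

definition topmost_one :: "nat mat \<Rightarrow> nat \<Rightarrow> nat" where
  "topmost_one P j = Min {i. i < dim_row P \<and> P $$ (i, j) = 1}"

definition parallelogram_polyominoes :: "nat \<Rightarrow> nat \<Rightarrow> nat mat set" where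
  "parallelogram_polyominoes m n = {P \<in> tableaux m n.
     P $$ (0, 0) = 1 \<and> P $$ (m - 1, n - 1) = 1 \<and>
     (\<forall>i<m. \<exists>j<n. P $$ (i, j) = 1) \<and>
     (\<forall>i<m. \<forall>j k l. j < k \<and> k < l \<and> l < n \<and> P $$ (i, j) = 1 \<and> P $$ (i, l) = 1
        \<longrightarrow> P $$ (i, k) = 1) \<and>
     (\<forall>i. 1 \<le> i \<and> i < m \<longrightarrow>
        leftmost_one P (i - 1) \<le> leftmost_one P i \<and>
        leftmost_one P i \<le> rightmost_one P (i - 1) \<and>
        rightmost_one P (i - 1) \<le> rightmost_one P i)}"

definition ribbon_parallelogram_polyominoes :: "nat \<Rightarrow> nat \<Rightarrow> nat mat set" where
  "ribbon_parallelogram_polyominoes m n = {P \<in> parallelogram_polyominoes m n.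
     card {(i, j). i < m \<and> j < n \<and> P $$ (i, j) = 1} = m + n - 1}"

text \<open>
  A labelling is the list of the \<open>m\<close> row labels followed by the \<open>n\<close> column labels.
\<close>

definition labelled_parallelogram_polyominoes :: "nat \<Rightarrow> nat \<Rightarrow> (nat mat \<times> nat list) set" where
  "labelled_parallelogram_polyominoes m n = {(P, l).
     P \<in> parallelogram_polyominoes m n \<and> length l = m + n \<and>
     take m l \<in> permutations_of_set {0..<m} \<and>
     l ! 0 = 0 \<and>
     (\<forall>i' i. i' < i \<and> i < m \<and> leftmost_one P i' = leftmost_one P i \<longrightarrow> l ! i' < l ! i) \<and>
     drop m l \<in> permutations_of_set {m..<m + n} \<and>
     (\<forall>j' j. j' < j \<and> j < n \<and> topmost_one P j' = topmost_one P j
        \<longrightarrow> l ! (m + j') < l ! (m + j))}"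

definition LRib :: "nat \<Rightarrow> nat \<Rightarrow> (nat mat \<times> nat list) set" where
  "LRib m n = {(P, l) \<in> labelled_parallelogram_polyominoes m n.
     P \<in> ribbon_parallelogram_polyominoes m n}"

text \<open>
  As with \<^const>\<open>permute_list\<close>, the entry at a position of the permuted object comes from the
  image of that position; permuting a list of labels by the same permutation therefore carries
  the labels along.
\<close>

definition permute_cols :: "(nat \<Rightarrow> nat) \<Rightarrow> nat mat \<Rightarrow> nat mat" where
  "permute_cols \<sigma> T = mat (dim_row T) (dim_col T) (\<lambda>(i, j). T $$ (i, \<sigma> j))"

definition permute_rows :: "(nat \<Rightarrow> nat) \<Rightarrow> nat mat \<Rightarrow> nat mat" where
  "permute_rows \<rho> T = mat (dim_row T) (dim_col T) (\<lambda>(i, j). T $$ (\<rho> i, j))"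

definition arranges_cols :: "nat list \<Rightarrow> nat mat \<Rightarrow> (nat \<Rightarrow> nat) \<Rightarrow> bool" where
  "arranges_cols cl T \<sigma> \<longleftrightarrow>
     \<sigma> permutes {..<dim_col T} \<and>
     (let T1 = permute_cols \<sigma> T; cl1 = permute_list \<sigma> cl in
       (\<forall>i<dim_row T. \<forall>j' j. j' < j \<and> j < dim_col T \<and> T1 $$ (i, j) = 0
          \<longrightarrow> T1 $$ (i, j') = 0) \<and>
       (\<forall>j' j. j' < j \<and> j < dim_col T \<and> col T1 j' = col T1 j \<longrightarrow> cl1 ! j' < cl1 ! j))"

definition arranges_rows :: "nat list \<Rightarrow> nat mat \<Rightarrow> (nat \<Rightarrow> nat) \<Rightarrow> bool" where
  "arranges_rows rl T \<rho> \<longleftrightarrow>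
     \<rho> permutes {..<dim_row T} \<and>
     (let T1 = permute_rows \<rho> T; rl1 = permute_list \<rho> rl in
       (\<forall>j<dim_col T. \<forall>i' i. i' < i \<and> i < dim_row T \<and> T1 $$ (i, j) = 1
          \<longrightarrow> T1 $$ (i', j) = 1) \<and>
       (\<forall>i' i. i' < i \<and> i < dim_row T \<and> row T1 i' = row T1 i \<longrightarrow> rl1 ! i' < rl1 ! i))"

definition ribbon_tableau :: "nat \<Rightarrow> nat \<Rightarrow> nat mat \<Rightarrow> nat mat" where
  "ribbon_tableau m n T' = mat m n (\<lambda>(i, j).
     if (T' $$ (i, j) = 1 \<and> (i = m - 1 \<or> T' $$ (i + 1, j) = 0)) \<or>
        (T' $$ (i, j) = 0 \<and> (j = n - 1 \<or> T' $$ (i, j + 1) = 1))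
     then 1 else 0)"

text \<open>
  For an EW-tableau, the zero positions of its columns are linearly ordered by inclusion, and so
  are those of its rows; ties being broken by labels, the arranging permutations below are unique.
\<close>

definition \<phi> :: "nat \<Rightarrow> nat \<Rightarrow> nat mat \<Rightarrow> nat mat \<times> nat list" where
  "\<phi> m n T =
     (let rl = [0..<m]; cl = [m..<m + n];
          \<sigma> = (THE \<sigma>. arranges_cols cl T \<sigma>);
          T1 = permute_cols \<sigma> T;
          \<rho> = (THE \<rho>. arranges_rows rl T1 \<rho>);
          T' = permute_rows \<rho> T1
      in (ribbon_tableau m n T', permute_list \<rho> rl @ permute_list \<sigma> cl))"

end

theory Submission
  imports Defs
begin

text \<open>
  An arranged EW-tableau is a staircase: row \<open>i\<close> consists of \<open>z i\<close> zeros followed by ones, with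
  \<open>0 = z 0 < z 1 \<le> \<dots> \<le> z (m - 1) \<le> n\<close>. Putting \<open>z m = n\<close>, row \<open>i\<close> of the associated ribbon
  occupies the columns from \<open>z i - 1\<close> (from \<open>0\<close> if \<open>i = 0\<close>) to \<open>z (Suc i) - 1\<close>. Conversely, counting
  cells shows that in a parallelogram polyomino with \<open>m + n - 1\<close> cells consecutive rows overlap in
  exactly one column, so it is the ribbon of a unique \<open>z\<close>. Rows below the top one (columns) of the
  staircase are equal iff their leftmost (topmost) ones in the ribbon are aligned; the top row, which
  may be aligned with the next ones, carries the least label. Hence both tie-breaking rules on labels
  agree, and the labels are the arranging permutations. EW-tableaux and labelled ribbons are thus
  both encoded by the same triples of \<open>z\<close> and two permutations.
\<close>

unbundle no m_inv_syntax

section \<open>Sorting permutations: existence and uniqueness\<close>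

text \<open>Monotonicity gives \<open>i \<le> p i\<close> by upward induction. Downward induction
  from \<open>n\<close> then excludes \<open>i < p i\<close>: such a \<open>p i\<close> would
  already be a fixed point, against injectivity.\<close>

lemma permutes_strict_mono_eq_id:
  fixes p :: "nat \<Rightarrow> nat"
  assumes p: "p permutes {..<n}" and mono: "\<And>i j. i < j \<Longrightarrow> j < n \<Longrightarrow> p i < p j"
  shows "p = id"
proof -
  have ge: "i \<le> p i" if "i < n" for i
    using that
  proof (induction i)
    case (Suc i)
    then have "i \<le> p i" "p i < p (Suc i)" using mono[of i "Suc i"] by auto
    then show ?case by simp
  qed simp
  have "p i = i" if "i < n" for i
    using that
  proof (induction "n - i" arbitrary: i rule: less_induct)
    case less
    have pi: "p i < n" using permutes_in_image[OF p, of i] less.prems by simp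
    have ge_i: "i \<le> p i" using ge less.prems by blast
    show ?case
    proof (rule ccontr)
      assume "p i \<noteq> i"
      then have "i < p i" using ge_i by simp
      then have "p (p i) = p i" using less.hyps[of "p i"] pi less.prems by simp
      then have "p i = i" using permutes_inj[OF p] by (auto dest: injD)
      with \<open>p i \<noteq> i\<close> show False by simp
    qed
  qed
  then show ?thesis using permutes_not_in[OF p] by (metis eq_id_iff lessThan_iff)
qed

text \<open>If both permutations list the indices in \<open>Q\<close>-order, then
  \<open>inv \<tau> \<circ> \<sigma>\<close> is strictly increasing, since an inversion would give
  \<open>Q\<close> in both directions; so it is the identity. This evaluates the definite
  descriptions in \<open>\<phi>\<close>.\<close>

lemma arranging_permutation_unique:
  fixes \<sigma> \<tau> :: "nat \<Rightarrow> nat"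
  assumes \<sigma>: "\<sigma> permutes {..<n}" and \<tau>: "\<tau> permutes {..<n}"
    and Q\<sigma>: "\<And>i j. i < j \<Longrightarrow> j < n \<Longrightarrow> Q (\<sigma> i) (\<sigma> j)"
    and Q\<tau>: "\<And>i j. i < j \<Longrightarrow> j < n \<Longrightarrow> Q (\<tau> i) (\<tau> j)"
    and asym: "\<And>a b. Q a b \<Longrightarrow> Q b a \<Longrightarrow> False"
  shows "\<sigma> = \<tau>"
proof -
  have inv_\<tau>: "inv \<tau> permutes {..<n}" using \<tau> by (rule permutes_inv)
  have \<tau>_inv: "\<tau> (inv \<tau> x) = x" for x using \<tau> by (simp add: permutes_inverses)
  have "inv \<tau> \<circ> \<sigma> = id"
  proof (rule permutes_strict_mono_eq_id)
    show "inv \<tau> \<circ> \<sigma> permutes {..<n}" using \<sigma> inv_\<tau> by (rule permutes_compose)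
  next
    fix i j :: nat assume ij: "i < j" "j < n"
    show "(inv \<tau> \<circ> \<sigma>) i < (inv \<tau> \<circ> \<sigma>) j"
    proof (rule ccontr)
      assume "\<not> (inv \<tau> \<circ> \<sigma>) i < (inv \<tau> \<circ> \<sigma>) j"
      then consider "inv \<tau> (\<sigma> j) < inv \<tau> (\<sigma> i)" | "inv \<tau> (\<sigma> i) = inv \<tau> (\<sigma> j)" by force
      then show False
      proof cases
        case 1
        have "inv \<tau> (\<sigma> i) < n"
          using permutes_in_image[OF \<sigma>, of i] permutes_in_image[OF inv_\<tau>, of "\<sigma> i"] ij by simp
        then have "Q (\<tau> (inv \<tau> (\<sigma> j))) (\<tau> (inv \<tau> (\<sigma> i)))" by (rule Q\<tau>[OF 1])
        then show False using asym Q\<sigma>[OF ij] by (simp add: \<tau>_inv)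
      next
        case 2
        then have "\<sigma> i = \<sigma> j" by (metis \<tau>_inv)
        then show False using ij permutes_inj[OF \<sigma>] by (auto dest: injD)
      qed
    qed
  qed
  then have "\<tau> \<circ> (inv \<tau> \<circ> \<sigma>) = \<tau>" by simp
  then show ?thesis by (auto simp: fun_eq_iff \<tau>_inv)
qed

lemma ex_permutes_strict_mono:
  fixes f :: "nat \<Rightarrow> nat"
  assumes "inj_on f {..<n}"
  obtains \<sigma> where "\<sigma> permutes {..<n}" "\<And>i j. i < j \<Longrightarrow> j < n \<Longrightarrow> f (\<sigma> i) < f (\<sigma> j)"
proof -
  define xs where "xs = sort_key f [0..<n]"
  have xs: "length xs = n" "set xs = {..<n}" "distinct xs" "sorted (map f xs)"
    by (auto simp: xs_def)
  define \<sigma> where "\<sigma> = (\<lambda>j. if j < n then xs ! j else j)"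
  have "bij_betw ((!) xs) {..<n} {..<n}"
    using xs by (intro bij_betw_nth) auto
  then have "bij_betw \<sigma> {..<n} {..<n}"
    by (rule bij_betw_cong[THEN iffD1, rotated]) (auto simp: \<sigma>_def)
  then have "\<sigma> permutes {..<n}" by (rule bij_imp_permutes) (auto simp: \<sigma>_def)
  moreover have "f (\<sigma> i) < f (\<sigma> j)" if "i < j" "j < n" for i j
  proof -
    have "f (xs ! i) \<le> f (xs ! j)"
      using sorted_nth_mono[OF xs(4), of i j] that xs(1) by simp
    moreover have "xs ! i \<noteq> xs ! j" using xs that by (simp add: nth_eq_iff_index_eq)
    moreover have "xs ! i \<in> {..<n}" "xs ! j \<in> {..<n}"
      using that nth_mem[of i xs] nth_mem[of j xs] unfolding xs by auto
    ultimately show ?thesis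
      using that assms by (auto simp: \<sigma>_def le_less dest: inj_onD)
  qed
  ultimately show ?thesis by (rule that)
qed

text \<open>The key \<open>card (A i) * n + i\<close> with \<open>i < n\<close> sorts
  lexicographically by cardinality, then by index. Along a chain of finite sets, cardinality decides
  inclusion, and the index breaks ties; reduction modulo \<open>n\<close> recovers the index, so the
  keys are distinct.\<close>

lemma ex_arranging_permutation:
  fixes A :: "nat \<Rightarrow> 'a set"
  assumes fin: "\<And>i. i < n \<Longrightarrow> finite (A i)"
    and chain: "\<And>i j. i < n \<Longrightarrow> j < n \<Longrightarrow> A i \<subseteq> A j \<or> A j \<subseteq> A i"
  obtains \<sigma> where "\<sigma> permutes {..<n}"
    "\<And>i j. i < j \<Longrightarrow> j < n \<Longrightarrow> A (\<sigma> i) \<subseteq> A (\<sigma> j)"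
    "\<And>i j. i < j \<Longrightarrow> j < n \<Longrightarrow> A (\<sigma> i) = A (\<sigma> j) \<Longrightarrow> \<sigma> i < \<sigma> j"
proof -
  define f where "f = (\<lambda>i. card (A i) * n + i)"
  have "inj_on f {..<n}"
  proof (rule inj_onI)
    fix x y assume xy: "x \<in> {..<n}" "y \<in> {..<n}" "f x = f y"
    then have "f x mod n = f y mod n" by simp
    then show "x = y" using xy by (simp add: f_def)
  qed
  then obtain \<sigma> where \<sigma>: "\<sigma> permutes {..<n}"
    and mono: "\<And>i j. i < j \<Longrightarrow> j < n \<Longrightarrow> f (\<sigma> i) < f (\<sigma> j)"
    by (rule ex_permutes_strict_mono) blast
  show ?thesis
  proof (rule that[OF \<sigma>])
    fix i j assume ij: "i < j" "j < n"
    have lt: "\<sigma> i < n" "\<sigma> j < n"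
      using permutes_in_image[OF \<sigma>, of i] permutes_in_image[OF \<sigma>, of j] ij by auto
    show "A (\<sigma> i) \<subseteq> A (\<sigma> j)"
    proof (rule ccontr)
      assume "\<not> A (\<sigma> i) \<subseteq> A (\<sigma> j)"
      then have "A (\<sigma> j) \<subset> A (\<sigma> i)" using chain[OF lt] by blast
      then have "Suc (card (A (\<sigma> j))) \<le> card (A (\<sigma> i))"
        using fin lt by (simp add: psubset_card_mono Suc_leI)
      then have "Suc (card (A (\<sigma> j))) * n \<le> card (A (\<sigma> i)) * n" by (rule mult_le_mono1)
      then show False using mono[OF ij] lt by (simp add: f_def)
    qed
    show "\<sigma> i < \<sigma> j" if "A (\<sigma> i) = A (\<sigma> j)"
      using mono[OF ij] that by (simp add: f_def)
  qed
qed

text \<open>Used to replace the set of zero positions of an arranged row by their number.\<close>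

lemma down_closed_eq_lessThan:
  fixes X :: "nat set"
  assumes "finite X" and down: "\<And>i j. i < j \<Longrightarrow> j \<in> X \<Longrightarrow> i \<in> X"
  shows "X = {..<card X}"
proof (cases "X = {}")
  case False
  then have "Max X \<in> X" using assms by simp
  have "X = {..Max X}"
  proof (intro equalityI subsetI)
    show "x \<in> {..Max X}" if "x \<in> X" for x using that assms by simp
    show "x \<in> X" if "x \<in> {..Max X}" for x
      using that down[of x "Max X"] \<open>Max X \<in> X\<close> by (cases "x = Max X") auto
  qed
  then show ?thesis
    by (metis card_lessThan lessThan_Suc_atMost)
qed simp

section \<open>Staircase profiles and the tableaux and ribbons they encode\<close>

text \<open>
  In an arranged tableau, \<open>z i\<close> is the number of zeros in row \<open>i\<close>. The extra value
  \<open>z m = n\<close> makes the ribbon formula uniform in the last row.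
\<close>

definition profile :: "nat \<Rightarrow> nat \<Rightarrow> (nat \<Rightarrow> nat) \<Rightarrow> bool" where
  "profile m n z \<longleftrightarrow> z 0 = 0 \<and> 1 \<le> z 1 \<and> z m = n \<and> (\<forall>i<m. z i \<le> z (Suc i))"

text \<open>This is the common code for both sides of the bijection. Positions \<open>j'\<close> and
  \<open>j\<close> hold identical staircase columns exactly when no \<open>z i\<close> with
  \<open>i < m\<close> separates them. The condition \<open>\<rho> 0 = 0\<close> keeps the row of
  ones at the top.\<close>

definition arrangement :: "nat \<Rightarrow> nat \<Rightarrow> (nat \<Rightarrow> nat) \<Rightarrow> (nat \<Rightarrow> nat) \<Rightarrow> (nat \<Rightarrow> nat) \<Rightarrow> bool" where
  "arrangement m n z \<rho> \<sigma> \<longleftrightarrow> profile m n z \<and> \<rho> permutes {..<m} \<and> \<sigma> permutes {..<n} \<and> \<rho> 0 = 0 \<and>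
     (\<forall>i' i. i' < i \<and> i < m \<and> z i' = z i \<longrightarrow> \<rho> i' < \<rho> i) \<and>
     (\<forall>j' j. j' < j \<and> j < n \<and> (\<forall>i<m. j' < z i \<longleftrightarrow> j < z i) \<longrightarrow> \<sigma> j' < \<sigma> j)"

text \<open>The tableau before arrangement: the inverses undo the sorting, so that position
  \<open>(i, j)\<close> of the staircase is read at \<open>(\<rho> i, \<sigma> j)\<close>, in
  keeping with \<open>permute_rows\<close> and \<open>permute_cols\<close>.\<close>

definition arranged_tableau ::
    "nat \<Rightarrow> nat \<Rightarrow> (nat \<Rightarrow> nat) \<Rightarrow> (nat \<Rightarrow> nat) \<Rightarrow> (nat \<Rightarrow> nat) \<Rightarrow> nat mat" where
  "arranged_tableau m n z \<rho> \<sigma> = mat m n (\<lambda>(i, j). if inv \<sigma> j < z (inv \<rho> i) then 0 else 1)"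

text \<open>Truncated subtraction starts the top row in column 0. Rows \<open>i\<close> and
  \<open>Suc i\<close> share just the column \<open>z (Suc i) - 1\<close>.\<close>

definition ribbon_of :: "nat \<Rightarrow> nat \<Rightarrow> (nat \<Rightarrow> nat) \<Rightarrow> nat mat" where
  "ribbon_of m n z = mat m n (\<lambda>(i, j). if z i - 1 \<le> j \<and> j < z (Suc i) then 1 else 0)"

definition labels_of :: "nat \<Rightarrow> nat \<Rightarrow> (nat \<Rightarrow> nat) \<Rightarrow> (nat \<Rightarrow> nat) \<Rightarrow> nat list" where
  "labels_of m n \<rho> \<sigma> = map \<rho> [0..<m] @ map (\<lambda>j. m + \<sigma> j) [0..<n]"

lemma labels_of_nth:
  shows "i < m \<Longrightarrow> labels_of m n \<rho> \<sigma> ! i = \<rho> i"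
    and "j < n \<Longrightarrow> labels_of m n \<rho> \<sigma> ! (m + j) = m + \<sigma> j"
  by (simp_all add: labels_of_def nth_append)

lemma profile_mono:
  assumes "profile m n z" "i \<le> k" "k \<le> m"
  shows "z i \<le> z k"
  using assms(2,3)
proof (induction k rule: dec_induct)
  case (step k)
  then have "z k \<le> z (Suc k)" using assms(1) by (simp add: profile_def)
  with step show ?case by simp
qed simp

lemma profile_pos:
  assumes "profile m n z" "1 \<le> i" "i \<le> m"
  shows "1 \<le> z i"
  using profile_mono[OF assms] assms(1) unfolding profile_def by linarith

lemma profile_le:
  assumes "profile m n z" "i \<le> m"
  shows "z i \<le> n"
  using profile_mono[OF assms(1,2)] assms(1) unfolding profile_def by simp

lemma tableaux_iff:
  "T \<in> tableaux m n \<longleftrightarrow>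
     T \<in> carrier_mat m n \<and> (\<forall>i<m. \<forall>j<n. T $$ (i, j) = 0 \<or> T $$ (i, j) = 1)"
proof (cases "T \<in> carrier_mat m n")
  case True
  have "elements_mat T \<subseteq> {0, 1} \<longleftrightarrow> (\<forall>i<m. \<forall>j<n. T $$ (i, j) \<in> {0, 1})"
  proof (intro iffI allI impI subsetI)
    show "T $$ (i, j) \<in> {0, 1}" if "elements_mat T \<subseteq> {0, 1}" "i < m" "j < n" for i j
      using elements_matI[OF True that(2,3) refl] that(1) by (rule set_mp[rotated])
    show "a \<in> {0, 1}" if all: "\<forall>i<m. \<forall>j<n. T $$ (i, j) \<in> {0, 1}" and a: "a \<in> elements_mat T" for a
    proof -
      obtain i j where "i < dim_row T" "j < dim_col T" "a = T $$ (i, j)"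
        using elements_matD[OF a] by blast
      then show ?thesis using all carrier_matD[OF True] by metis
    qed
  qed
  with True show ?thesis by (simp add: tableaux_def)
qed (simp add: tableaux_def)

lemma
  assumes "\<rho> permutes {..<m}" "\<sigma> permutes {..<n}"
  shows arranged_tableau_index: "\<And>i j. i < m \<Longrightarrow> j < n \<Longrightarrow>
      arranged_tableau m n z \<rho> \<sigma> $$ (\<rho> i, \<sigma> j) = (if j < z i then 0 else 1)"
    and arranged_tableau_eqI: "\<And>T. T \<in> carrier_mat m n \<Longrightarrow>
      (\<And>i j. i < m \<Longrightarrow> j < n \<Longrightarrow> T $$ (\<rho> i, \<sigma> j) = (if j < z i then 0 else 1)) \<Longrightarrow>
      T = arranged_tableau m n z \<rho> \<sigma>"
proof -
  show "arranged_tableau m n z \<rho> \<sigma> $$ (\<rho> i, \<sigma> j) = (if j < z i then 0 else 1)"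
    if "i < m" "j < n" for i j
    using that permutes_in_image[OF assms(1), of i] permutes_in_image[OF assms(2), of j]
    by (simp add: arranged_tableau_def permutes_inverses[OF assms(1)] permutes_inverses[OF assms(2)])
  show "T = arranged_tableau m n z \<rho> \<sigma>"
    if T: "T \<in> carrier_mat m n"
      "\<And>i j. i < m \<Longrightarrow> j < n \<Longrightarrow> T $$ (\<rho> i, \<sigma> j) = (if j < z i then 0 else 1)" for T
  proof (rule eq_matI)
    fix i j assume ij: "i < dim_row (arranged_tableau m n z \<rho> \<sigma>)"
      "j < dim_col (arranged_tableau m n z \<rho> \<sigma>)"
    then have "i < m" "j < n" by (auto simp: arranged_tableau_def)
    then have "inv \<rho> i < m" "inv \<sigma> j < n"
      using permutes_in_image[OF permutes_inv[OF assms(1)], of i]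
        permutes_in_image[OF permutes_inv[OF assms(2)], of j] by auto
    with T(2)[OF this] \<open>i < m\<close> \<open>j < n\<close> show "T $$ (i, j) = arranged_tableau m n z \<rho> \<sigma> $$ (i, j)"
      by (simp add: arranged_tableau_def permutes_inverses[OF assms(1)] permutes_inverses[OF assms(2)])
  qed (use T in \<open>auto simp: arranged_tableau_def\<close>)
qed

section \<open>EW-tableaux are the tableaux encoded by arrangements\<close>

lemma arranged_tableau_in_EW:
  assumes m: "1 \<le> m" and n: "1 \<le> n" and arr: "arrangement m n z \<rho> \<sigma>"
  shows "arranged_tableau m n z \<rho> \<sigma> \<in> EW m n"
proof -
  let ?T = "arranged_tableau m n z \<rho> \<sigma>"
  from arr have prof: "profile m n z" and \<rho>: "\<rho> permutes {..<m}" and \<sigma>: "\<sigma> permutes {..<n}"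
    and \<rho>0: "\<rho> 0 = 0" by (auto simp: arrangement_def)
  have z0: "z 0 = 0" using prof by (simp add: profile_def)
  have inv0: "inv \<rho> 0 = 0" using \<rho> \<rho>0 by (metis permutes_inverses(2))
  have ix: "?T $$ (i, j) = (if inv \<sigma> j < z (inv \<rho> i) then 0 else 1)" if "i < m" "j < n" for i j
    using that by (simp add: arranged_tableau_def)
  have "\<exists>j<n. ?T $$ (i, j) = 0" if "i < m" "i \<noteq> 0" for i
  proof (intro exI conjI)
    show \<sigma>0: "\<sigma> 0 < n" using permutes_in_image[OF \<sigma>, of 0] n by simp
    \<comment> \<open>Only staircase row 0 is free of zeros, and it is row 0 of the tableau. Every
      other row has a zero in the first staircase column, which is column
      \<open>\<sigma> 0\<close>.\<close>
    have "inv \<rho> i < m" using permutes_in_image[OF permutes_inv[OF \<rho>], of i] that by simp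
    moreover have "inv \<rho> i \<noteq> 0" using \<rho> \<rho>0 that by (metis permutes_inverses(1))
    ultimately have "1 \<le> z (inv \<rho> i)" using profile_pos[OF prof, of "inv \<rho> i"] by simp
    then show "?T $$ (i, \<sigma> 0) = 0"
      using that \<sigma>0 by (simp add: ix permutes_inverses[OF \<sigma>])
  qed
  moreover have "?T \<in> tableaux m n"
    unfolding tableaux_iff by (auto simp: arranged_tableau_def)
  moreover have "\<forall>j<n. ?T $$ (0, j) = 1" using m by (simp add: ix inv0 z0)
  \<comment> \<open>The forbidden pattern would give the cycle \<open>inv \<sigma> k < z (inv \<rho>
    i) \<le> inv \<sigma> k' < z (inv \<rho> i') \<le> inv \<sigma> k\<close>.\<close>
  moreover have "\<not> (\<exists>i<m. \<exists>i'<m. \<exists>k<n. \<exists>k'<n. i \<noteq> i' \<and> k \<noteq> k' \<and>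
          ?T $$ (i, k) = 0 \<and> ?T $$ (i', k') = 0 \<and> ?T $$ (i, k') = 1 \<and> ?T $$ (i', k) = 1)"
    by (auto simp: ix split: if_splits)
  ultimately show ?thesis unfolding EW_def by blast
qed

text \<open>The forbidden pattern is exactly a failure of inclusion in both directions, for the
  one-sets of two columns as well as for the zero-sets of two rows. Both families are therefore
  chains and can be sorted.\<close>

lemma EW_imp_arranged_tableau:
  assumes m: "1 \<le> m" and n: "1 \<le> n" and T: "T \<in> EW m n"
  obtains z \<rho> \<sigma> where "arrangement m n z \<rho> \<sigma>" "T = arranged_tableau m n z \<rho> \<sigma>"
proof -
  have tab: "T \<in> tableaux m n" using T unfolding EW_def by blast
  have carrier: "T \<in> carrier_mat m n" using tab by (simp add: tableaux_iff)
  have bin: "T $$ (i, j) = 0 \<or> T $$ (i, j) = 1" if "i < m" "j < n" for i j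
    using tab that unfolding tableaux_iff by blast
  have top: "T $$ (0, j) = 1" if "j < n" for j using T that unfolding EW_def by blast
  have zero: "\<exists>j<n. T $$ (i, j) = 0" if "i < m" "i \<noteq> 0" for i
    using T that unfolding EW_def by blast
  have no_cross: "\<not> (\<exists>i<m. \<exists>i'<m. \<exists>k<n. \<exists>k'<n. i \<noteq> i' \<and> k \<noteq> k' \<and>
          T $$ (i, k) = 0 \<and> T $$ (i', k') = 0 \<and> T $$ (i, k') = 1 \<and> T $$ (i', k) = 1)"
    using T unfolding EW_def mem_Collect_eq by (elim conjE)
  have cross: False if "i < m" "i' < m" "k < n" "k' < n" "T $$ (i, k) = 0" "T $$ (i', k') = 0"
    "T $$ (i, k') \<noteq> 0" "T $$ (i', k) \<noteq> 0" for i i' k k'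
  proof -
    have "T $$ (i, k') = 1" "T $$ (i', k) = 1"
      using bin[of i k'] bin[of i' k] that by simp_all
    moreover have "i \<noteq> i'" "k \<noteq> k'" using that by auto
    ultimately show False using no_cross that by blast
  qed
  \<comment> \<open>Ones are collected in columns but zeros in rows: increasing order of
    \<open>A\<close> moves zeros to the left, and increasing order of \<open>B\<close> moves ones to
    the top.\<close>
  define A where "A = (\<lambda>j. {i. i < m \<and> T $$ (i, j) \<noteq> 0})"
  define B where "B = (\<lambda>i. {j. j < n \<and> T $$ (i, j) = 0})"
  have finA: "finite (A j)" and finB: "finite (B j)" for j by (auto simp: A_def B_def)
  have "A j \<subseteq> A j' \<or> A j' \<subseteq> A j" if "j < n" "j' < n" for j j'
    unfolding A_def using cross that by blast
  then obtain \<sigma> where \<sigma>: "\<sigma> permutes {..<n}"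
    and A_mono: "\<And>i j. i < j \<Longrightarrow> j < n \<Longrightarrow> A (\<sigma> i) \<subseteq> A (\<sigma> j)"
    and A_eq: "\<And>i j. i < j \<Longrightarrow> j < n \<Longrightarrow> A (\<sigma> i) = A (\<sigma> j) \<Longrightarrow> \<sigma> i < \<sigma> j"
    using ex_arranging_permutation[of n A, OF finA] by metis
  have "B i \<subseteq> B i' \<or> B i' \<subseteq> B i" if "i < m" "i' < m" for i i'
    unfolding B_def using cross that by blast
  then obtain \<rho> where \<rho>: "\<rho> permutes {..<m}"
    and B_mono: "\<And>i j. i < j \<Longrightarrow> j < m \<Longrightarrow> B (\<rho> i) \<subseteq> B (\<rho> j)"
    and B_eq: "\<And>i j. i < j \<Longrightarrow> j < m \<Longrightarrow> B (\<rho> i) = B (\<rho> j) \<Longrightarrow> \<rho> i < \<rho> j"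
    using ex_arranging_permutation[of m B, OF finB] by metis
  have \<sigma>_lt: "\<sigma> j < n" if "j < n" for j using permutes_in_image[OF \<sigma>, of j] that by simp
  have \<rho>_lt: "\<rho> i < m" if "i < m" for i using permutes_in_image[OF \<rho>, of i] that by simp
  define z where "z = (\<lambda>i. if i < m then card (B (\<rho> i)) else n)"
  have B0: "B 0 = {}" using top by (auto simp: B_def)
  have B_ne: "B i \<noteq> {}" if "i < m" "i \<noteq> 0" for i using zero[OF that] by (auto simp: B_def)
  have \<rho>0: "\<rho> 0 = 0"
  \<comment> \<open>Let \<open>k\<close> be the position where the top row ends up. If
    \<open>k > 0\<close>, then \<open>B (\<rho> 0)\<close> is also empty, and the tie-break yields
    \<open>\<rho> 0 < \<rho> k = 0\<close>, which is absurd.\<close>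
  proof -
    obtain k where k: "\<rho> k = 0" using permutes_surj[OF \<rho>] by (metis surj_def)
    have "k < m" using permutes_in_image[OF \<rho>, of k] k m by simp
    show ?thesis
    proof (cases "k = 0")
      case False
      then have "B (\<rho> 0) \<subseteq> B (\<rho> k)" using B_mono[of 0 k] \<open>k < m\<close> by simp
      then have "B (\<rho> 0) = B (\<rho> k)" using B0 k by simp
      then show ?thesis using B_eq[of 0 k] \<open>k < m\<close> k False by simp
    qed (use k in simp)
  qed
  have z_le: "z i \<le> n" for i
    using card_mono[of "{..<n}" "B (\<rho> i)"] by (auto simp: z_def B_def)
  have prof: "profile m n z"
    unfolding profile_def
  proof (intro conjI allI impI)
    show "z 0 = 0" using m \<rho>0 B0 by (simp add: z_def)
    show "1 \<le> z 1"
    proof (cases "1 < m")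
      case True
      then have "\<rho> 1 \<noteq> 0" using \<rho>0 permutes_inj[OF \<rho>] by (metis injD zero_neq_one)
      then show ?thesis using True B_ne[OF \<rho>_lt[of 1]] finB by (simp add: z_def Suc_leI card_gt_0_iff)
    qed (use n in \<open>simp add: z_def\<close>)
    show "z m = n" by (simp add: z_def)
    show "z i \<le> z (Suc i)" if "i < m" for i
    proof (cases "Suc i < m")
      case True
      then show ?thesis using B_mono[of i "Suc i"] finB by (simp add: z_def card_mono)
    next
      case False
      then show ?thesis using z_le[of i] by (simp add: z_def)
    qed
  qed
  \<comment> \<open>The zeros of row \<open>\<rho> i\<close>, read in the order
    \<open>\<sigma>\<close>, form an initial segment \<open>X\<close>. Since \<open>\<sigma>\<close>
    maps \<open>X\<close> bijectively onto \<open>B (\<rho> i)\<close>, its length is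
    \<open>z i\<close>.\<close>
  have entry: "T $$ (\<rho> i, \<sigma> j) = 0 \<longleftrightarrow> j < z i" if ij: "i < m" "j < n" for i j
  proof -
    define X where "X = {j. j < n \<and> T $$ (\<rho> i, \<sigma> j) = 0}"
    have "X = {..<card X}"
    proof (rule down_closed_eq_lessThan)
      show "finite X" by (simp add: X_def)
      show "a \<in> X" if ab: "a < b" "b \<in> X" for a b
      proof -
        from ab have "b < n" "T $$ (\<rho> i, \<sigma> b) = 0" by (auto simp: X_def)
        then have "\<rho> i \<notin> A (\<sigma> b)" by (simp add: A_def)
        then have "\<rho> i \<notin> A (\<sigma> a)" using A_mono[OF ab(1) \<open>b < n\<close>] by blast
        then show ?thesis using ab \<open>b < n\<close> \<rho>_lt[OF ij(1)] by (simp add: X_def A_def)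
      qed
    qed
    moreover have "\<sigma> ` X = B (\<rho> i)"
    proof (intro equalityI subsetI)
      fix k assume "k \<in> B (\<rho> i)"
      then have k: "k < n" "T $$ (\<rho> i, k) = 0" by (auto simp: B_def)
      have "inv \<sigma> k < n" using permutes_in_image[OF permutes_inv[OF \<sigma>], of k] k by simp
      then show "k \<in> \<sigma> ` X"
        using k by (intro image_eqI[of _ _ "inv \<sigma> k"]) (auto simp: X_def permutes_inverses[OF \<sigma>])
    qed (auto simp: X_def B_def \<sigma>_lt)
    then have "card X = z i"
      using ij card_image[OF permutes_inj_on[OF \<sigma>], of X] by (simp add: z_def)
    ultimately have "j \<in> X \<longleftrightarrow> j < z i" by simp
    then show ?thesis using ij by (simp add: X_def)
  qed
  have "arrangement m n z \<rho> \<sigma>"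
    unfolding arrangement_def
  proof (intro conjI allI impI)
    fix i' i assume *: "i' < i \<and> i < m \<and> z i' = z i"
    then have "B (\<rho> i') \<subseteq> B (\<rho> i)" "card (B (\<rho> i')) = card (B (\<rho> i))"
      using B_mono[of i' i] by (auto simp: z_def)
    \<comment> \<open>Nested finite sets of equal size coincide, so equal profile values mean
      identical rows.\<close>
    then have "B (\<rho> i') = B (\<rho> i)" using finB card_subset_eq by blast
    then show "\<rho> i' < \<rho> i" using * B_eq[of i' i] by simp
  next
    fix j' j assume *: "j' < j \<and> j < n \<and> (\<forall>i<m. (j' < z i) = (j < z i))"
    have "(k \<in> A (\<sigma> j')) = (k \<in> A (\<sigma> j))" for k
    proof (cases "k < m")
      case True
      then have "inv \<rho> k < m" using permutes_in_image[OF permutes_inv[OF \<rho>], of k] by simp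
      then have "T $$ (\<rho> (inv \<rho> k), \<sigma> j') = 0 \<longleftrightarrow> T $$ (\<rho> (inv \<rho> k), \<sigma> j) = 0"
        using * by (simp add: entry)
      then show ?thesis using True by (simp add: A_def permutes_inverses[OF \<rho>] del: neq0_conv)
    qed (simp add: A_def)
    then show "\<sigma> j' < \<sigma> j" using * A_eq[of j' j] by blast
  qed (use prof \<rho> \<sigma> \<rho>0 in auto)
  moreover have "T = arranged_tableau m n z \<rho> \<sigma>"
  proof (rule arranged_tableau_eqI[OF \<rho> \<sigma> carrier])
    fix i j assume "i < m" "j < n"
    then show "T $$ (\<rho> i, \<sigma> j) = (if j < z i then 0 else 1)"
      using entry[of i j] bin[OF \<rho>_lt \<sigma>_lt, of i j] by (cases "j < z i") simp_all
  qed
  ultimately show ?thesis by (rule that)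
qed


section \<open>Evaluation of \<open>\<phi>\<close> on an encoded tableau\<close>

text \<open>The permutations \<open>\<sigma>\<close> and \<open>\<rho>\<close> of the code satisfy
  the arranging conditions, and uniqueness identifies them with the ones chosen by
  \<open>\<phi>\<close>. The arranged tableau is then the staircase, whose ribbon is computed
  entrywise.\<close>

lemma phi_arranged_tableau:
  assumes m: "1 \<le> m" and n: "1 \<le> n" and arr: "arrangement m n z \<rho> \<sigma>"
  shows "\<phi> m n (arranged_tableau m n z \<rho> \<sigma>) = (ribbon_of m n z, labels_of m n \<rho> \<sigma>)"
proof -
  let ?T = "arranged_tableau m n z \<rho> \<sigma>"
  let ?T1 = "permute_cols \<sigma> ?T"
  let ?T' = "mat m n (\<lambda>(i, j). if j < z i then 0 else 1) :: nat mat"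
  from arr have prof: "profile m n z" and \<rho>: "\<rho> permutes {..<m}" and \<sigma>: "\<sigma> permutes {..<n}"
    and row_ord: "\<And>i' i. i' < i \<Longrightarrow> i < m \<Longrightarrow> z i' = z i \<Longrightarrow> \<rho> i' < \<rho> i"
    and col_ord: "\<And>j' j. j' < j \<Longrightarrow> j < n \<Longrightarrow> (\<And>i. i < m \<Longrightarrow> j' < z i \<longleftrightarrow> j < z i) \<Longrightarrow> \<sigma> j' < \<sigma> j"
    unfolding arrangement_def by blast+
  have \<sigma>_lt: "\<sigma> j < n" if "j < n" for j using permutes_in_image[OF \<sigma>, of j] that by simp
  have \<rho>_lt: "\<rho> i < m" if "i < m" for i using permutes_in_image[OF \<rho>, of i] that by simp
  have dim: "dim_row ?T = m" "dim_col ?T = n" "dim_row ?T1 = m" "dim_col ?T1 = n"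
    by (auto simp: arranged_tableau_def permute_cols_def)
  have entry: "?T $$ (\<rho> i, \<sigma> j) = (if j < z i then 0 else 1)" if "i < m" "j < n" for i j
    using arranged_tableau_index[OF \<rho> \<sigma>] that by simp
  have T': "permute_rows \<rho> ?T1 = ?T'"
    by (rule eq_matI) (auto simp: permute_rows_def permute_cols_def dim \<rho>_lt entry)
  have row_inv: "\<exists>k<m. i = \<rho> k" if "i < m" for i
    using that permutes_in_image[OF permutes_inv[OF \<rho>], of i]
    by (intro exI[of _ "inv \<rho> i"]) (simp add: permutes_inverses[OF \<rho>])
  have cl: "permute_list \<tau> [m..<m + n] ! j = m + \<tau> j" if "\<tau> permutes {..<n}" "j < n" for \<tau> j
    using that permutes_in_image[OF that(1), of j] by (simp add: permute_list_nth)
  have rl: "permute_list \<tau> [0..<m] ! j = \<tau> j" if "\<tau> permutes {..<m}" "j < m" for \<tau> j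
    using that permutes_in_image[OF that(1), of j] by (simp add: permute_list_nth)
  have cols: "arranges_cols [m..<m + n] ?T \<sigma>"
    unfolding arranges_cols_def Let_def dim
  proof (intro conjI allI impI \<sigma>)
    fix i j' j assume i: "i < m" and *: "j' < j \<and> j < n \<and> ?T1 $$ (i, j) = 0"
    obtain k where "k < m" "i = \<rho> k" using row_inv i by blast
    then show "?T1 $$ (i, j') = 0"
      using i * by (auto simp: permute_cols_def dim entry split: if_splits)
  next
    fix j' j assume *: "j' < j \<and> j < n \<and> col ?T1 j' = col ?T1 j"
    have "j' < z i \<longleftrightarrow> j < z i" if "i < m" for i
    proof -
      have "col ?T1 j' $ \<rho> i = col ?T1 j $ \<rho> i" using * by simp
      then show ?thesis
        using * that \<rho>_lt by (auto simp: permute_cols_def dim entry split: if_splits)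
    qed
    then have "\<sigma> j' < \<sigma> j" using * by (intro col_ord) auto
    then show "permute_list \<sigma> [m..<m + n] ! j' < permute_list \<sigma> [m..<m + n] ! j"
      using * by (simp add: cl[OF \<sigma>])
  qed
  have the_\<sigma>: "(THE \<sigma>. arranges_cols [m..<m + n] ?T \<sigma>) = \<sigma>"
  proof (rule the_equality[where P = "arranges_cols [m..<m + n] ?T", OF cols])
    define C where "C = (\<lambda>k. {i. i < m \<and> ?T $$ (i, k) = 0})"
    \<comment> \<open>Every arranging permutation is sorted for \<open>Q\<close>: larger zero-sets
      come first because zeros propagate to the left, and equal columns are ordered by label.
      Antisymmetry of inclusion together with the strict tie-break makes \<open>Q\<close>
      asymmetric.\<close>
    define Q where "Q = (\<lambda>a b. C b \<subseteq> C a \<and> (C a = C b \<longrightarrow> a < b))"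
    have sorted: "\<tau> permutes {..<n} \<and> (\<forall>j' j. j' < j \<longrightarrow> j < n \<longrightarrow> Q (\<tau> j') (\<tau> j))"
      if *: "arranges_cols [m..<m + n] ?T \<tau>" for \<tau>
      unfolding Q_def
    proof (intro conjI allI impI)
      show \<tau>: "\<tau> permutes {..<n}" using * by (simp add: arranges_cols_def dim)
      have \<tau>_lt: "\<tau> j < n" if "j < n" for j using permutes_in_image[OF \<tau>, of j] that by simp
      have bin: "?T $$ (i, j) = 0 \<or> ?T $$ (i, j) = 1" if "i < m" "j < n" for i j
        using that by (simp add: arranged_tableau_def)
      fix j' j assume jj: "j' < j" "j < n"
      have P: "permute_cols \<tau> ?T $$ (i, j') = ?T $$ (i, \<tau> j')"
        "permute_cols \<tau> ?T $$ (i, j) = ?T $$ (i, \<tau> j)" if "i < m" for i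
        using jj that by (auto simp: permute_cols_def dim)
      have down: "permute_cols \<tau> ?T $$ (i, j') = 0" if "i < m" "permute_cols \<tau> ?T $$ (i, j) = 0" for i
        using * jj that unfolding arranges_cols_def Let_def dim by blast
      then show "C (\<tau> j) \<subseteq> C (\<tau> j')"
        by (auto simp: C_def P)
      assume C: "C (\<tau> j') = C (\<tau> j)"
      have "col (permute_cols \<tau> ?T) j' = col (permute_cols \<tau> ?T) j"
      proof (rule eq_vecI)
        fix i assume "i < dim_vec (col (permute_cols \<tau> ?T) j)"
        then have "i < m" by (simp add: permute_cols_def dim)
        have "i \<in> C (\<tau> j') \<longleftrightarrow> i \<in> C (\<tau> j)" by (simp add: C)
        then have Ci: "?T $$ (i, \<tau> j') = 0 \<longleftrightarrow> ?T $$ (i, \<tau> j) = 0"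
          using \<open>i < m\<close> by (simp add: C_def)
        from \<open>i < m\<close> show "col (permute_cols \<tau> ?T) j' $ i = col (permute_cols \<tau> ?T) j $ i"
          using Ci jj \<tau>_lt[of j] \<tau>_lt[of j'] bin[of i "\<tau> j"] bin[of i "\<tau> j'"]
          by (auto simp: permute_cols_def dim)
      qed simp
      then have "permute_list \<tau> [m..<m + n] ! j' < permute_list \<tau> [m..<m + n] ! j"
        using * jj unfolding arranges_cols_def Let_def dim by blast
      then show "\<tau> j' < \<tau> j" using jj by (simp add: cl[OF \<tau>])
    qed
    show "\<tau> = \<sigma>" if "arranges_cols [m..<m + n] ?T \<tau>" for \<tau>
    proof (rule arranging_permutation_unique[where Q = Q])
      show "\<tau> permutes {..<n}" "\<sigma> permutes {..<n}"
        using sorted[OF that] sorted[OF cols] by blast+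
      show "Q (\<tau> i) (\<tau> j)" "Q (\<sigma> i) (\<sigma> j)" if "i < j" "j < n" for i j
        using sorted[OF \<open>arranges_cols [m..<m + n] ?T \<tau>\<close>] sorted[OF cols] that by blast+
      show False if "Q a b" "Q b a" for a b
        using that unfolding Q_def by (metis less_asym subset_antisym)
    qed
  qed
  have rows: "arranges_rows [0..<m] ?T1 \<rho>"
    unfolding arranges_rows_def Let_def dim T'
  proof (intro conjI allI impI \<rho>)
    fix j i' i assume "j < n" and *: "i' < i \<and> i < m \<and> ?T' $$ (i, j) = 1"
    then show "?T' $$ (i', j) = 1"
      using profile_mono[OF prof, of i' i] by (auto split: if_splits)
  next
    fix i' i assume *: "i' < i \<and> i < m \<and> row ?T' i' = row ?T' i"
    have "j < z i' \<longleftrightarrow> j < z i" if "j < n" for j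
    proof -
      have "i' < m" "i < m" "row ?T' i' $ j = row ?T' i $ j" using * by simp_all
      then show ?thesis using that by (auto split: if_splits)
    qed
    \<comment> \<open>If the values differed, the smaller one would be below \<open>n\<close> and
      would itself be a column in which the two rows differ.\<close>
    then have "z i' = z i"
      using profile_le[OF prof, of i'] profile_le[OF prof, of i] *
      by (metis less_imp_le_nat linorder_neqE_nat order_less_le_trans less_irrefl_nat)
    then show "permute_list \<rho> [0..<m] ! i' < permute_list \<rho> [0..<m] ! i"
      using * row_ord by (simp add: rl[OF \<rho>])
  qed
  have the_\<rho>: "(THE \<rho>. arranges_rows [0..<m] ?T1 \<rho>) = \<rho>"
  proof (rule the_equality[where P = "arranges_rows [0..<m] ?T1", OF rows])
    define C where "C = (\<lambda>k. {j. j < n \<and> ?T1 $$ (k, j) = 1})"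
    \<comment> \<open>The same order for rows, now with one-sets, since ones propagate
      upwards.\<close>
    define Q where "Q = (\<lambda>a b. C b \<subseteq> C a \<and> (C a = C b \<longrightarrow> a < b))"
    have sorted: "\<tau> permutes {..<m} \<and> (\<forall>i' i. i' < i \<longrightarrow> i < m \<longrightarrow> Q (\<tau> i') (\<tau> i))"
      if *: "arranges_rows [0..<m] ?T1 \<tau>" for \<tau>
      unfolding Q_def
    proof (intro conjI allI impI)
      show \<tau>: "\<tau> permutes {..<m}" using * by (simp add: arranges_rows_def dim)
      have \<tau>_lt: "\<tau> i < m" if "i < m" for i using permutes_in_image[OF \<tau>, of i] that by simp
      have bin: "?T1 $$ (i, j) = 0 \<or> ?T1 $$ (i, j) = 1" if "i < m" "j < n" for i j
        using that \<sigma>_lt by (simp add: arranged_tableau_def permute_cols_def)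
      fix i' i assume ii: "i' < i" "i < m"
      have P: "permute_rows \<tau> ?T1 $$ (i', j) = ?T1 $$ (\<tau> i', j)"
        "permute_rows \<tau> ?T1 $$ (i, j) = ?T1 $$ (\<tau> i, j)" if "j < n" for j
        using ii that by (auto simp: permute_rows_def dim)
      have down: "permute_rows \<tau> ?T1 $$ (i', j) = 1" if "j < n" "permute_rows \<tau> ?T1 $$ (i, j) = 1" for j
        using * ii that unfolding arranges_rows_def Let_def dim by blast
      then show "C (\<tau> i) \<subseteq> C (\<tau> i')"
        by (auto simp: C_def P)
      assume C: "C (\<tau> i') = C (\<tau> i)"
      have "row (permute_rows \<tau> ?T1) i' = row (permute_rows \<tau> ?T1) i"
      proof (rule eq_vecI)
        fix j assume "j < dim_vec (row (permute_rows \<tau> ?T1) i)"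
        then have "j < n" by (simp add: permute_rows_def dim)
        have "j \<in> C (\<tau> i') \<longleftrightarrow> j \<in> C (\<tau> i)" by (simp add: C)
        then have Ci: "?T1 $$ (\<tau> i', j) = 1 \<longleftrightarrow> ?T1 $$ (\<tau> i, j) = 1"
          using \<open>j < n\<close> by (simp add: C_def)
        from \<open>j < n\<close> show "row (permute_rows \<tau> ?T1) i' $ j = row (permute_rows \<tau> ?T1) i $ j"
          using Ci ii \<tau>_lt[of i] \<tau>_lt[of i'] bin[of "\<tau> i" j] bin[of "\<tau> i'" j]
          by (auto simp: permute_rows_def dim)
      qed simp
      then have "permute_list \<tau> [0..<m] ! i' < permute_list \<tau> [0..<m] ! i"
        using * ii unfolding arranges_rows_def Let_def dim by blast
      then show "\<tau> i' < \<tau> i" using ii by (simp add: rl[OF \<tau>])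
    qed
    show "\<tau> = \<rho>" if "arranges_rows [0..<m] ?T1 \<tau>" for \<tau>
    proof (rule arranging_permutation_unique[where Q = Q])
      show "\<tau> permutes {..<m}" "\<rho> permutes {..<m}"
        using sorted[OF that] sorted[OF rows] by blast+
      show "Q (\<tau> i) (\<tau> j)" "Q (\<rho> i) (\<rho> j)" if "i < j" "j < m" for i j
        using sorted[OF \<open>arranges_rows [0..<m] ?T1 \<tau>\<close>] sorted[OF rows] that by blast+
      show False if "Q a b" "Q b a" for a b
        using that unfolding Q_def by (metis less_asym subset_antisym)
    qed
  qed
  have "ribbon_tableau m n ?T' = ribbon_of m n z"
    unfolding ribbon_tableau_def ribbon_of_def
  proof (rule cong_mat[OF refl refl], clarify)
    fix i j assume ij: "i < m" "j < n"
    have zm: "z m = n" using prof by (simp add: profile_def)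
    have "z i \<le> z (Suc i)" "1 \<le> z (Suc i)" "z (Suc i) \<le> n"
      using profile_mono[OF prof, of i "Suc i"] profile_pos[OF prof, of "Suc i"]
        profile_le[OF prof, of "Suc i"] ij by auto
    moreover have "i = m - 1 \<Longrightarrow> z (Suc i) = n" using zm ij by simp
    \<comment> \<open>For \<open>j \<ge> z i\<close> the entry is a one, and it is the lowest in its
      column iff \<open>j < z (Suc i)\<close>; in the last row this holds by \<open>z m = n\<close>.
      For \<open>j < z i\<close> it is a zero, and it is the last in its row iff
      \<open>j = z i - 1\<close>.\<close>
    ultimately have "((?T' $$ (i, j) = 1 \<and> (i = m - 1 \<or> ?T' $$ (i + 1, j) = 0)) \<or>
        (?T' $$ (i, j) = 0 \<and> (j = n - 1 \<or> ?T' $$ (i, j + 1) = 1)))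
        \<longleftrightarrow> z i - 1 \<le> j \<and> j < z (Suc i)"
      using ij by (cases "i = m - 1"; cases "j = n - 1"; cases "j < z i") auto
    then show "(if (?T' $$ (i, j) = 1 \<and> (i = m - 1 \<or> ?T' $$ (i + 1, j) = 0)) \<or>
        (?T' $$ (i, j) = 0 \<and> (j = n - 1 \<or> ?T' $$ (i, j + 1) = 1)) then 1 else 0) =
        (if z i - 1 \<le> j \<and> j < z (Suc i) then 1 else 0 :: nat)" by simp
  qed
  moreover have "permute_list \<rho> [0..<m] @ permute_list \<sigma> [m..<m + n] = labels_of m n \<rho> \<sigma>"
    unfolding labels_of_def
    by (intro arg_cong2[where f = "(@)"] nth_equalityI) (simp_all add: cl[OF \<sigma>] rl[OF \<rho>])
  ultimately show ?thesis
    by (simp add: \<phi>_def Let_def the_\<sigma> the_\<rho> T')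
qed

section \<open>Row ends and column tops of the ribbon of a profile\<close>

lemma ribbon_of_eq_1_iff:
  assumes "i < m" "j < n"
  shows "ribbon_of m n z $$ (i, j) = 1 \<longleftrightarrow> z i - 1 \<le> j \<and> j < z (Suc i)"
  using assms by (simp add: ribbon_of_def)

text \<open>Since \<open>z (Suc i)\<close> is positive, the strict upper bound becomes the closed
  bound \<open>z (Suc i) - 1\<close>, and every row is a nonempty interval.\<close>

lemma ribbon_row:
  assumes "profile m n z" "i < m"
  shows "{j. j < n \<and> ribbon_of m n z $$ (i, j) = 1} = {z i - 1..z (Suc i) - 1}"
    and "z i - 1 \<le> z (Suc i) - 1"
proof -
  have z: "z (Suc i) \<le> n" "1 \<le> z (Suc i)" "z i \<le> z (Suc i)"
    using assms(2) profile_le[OF assms(1), of "Suc i"] profile_pos[OF assms(1), of "Suc i"]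
      profile_mono[OF assms(1), of i "Suc i"] by simp_all
  have "{j. j < n \<and> ribbon_of m n z $$ (i, j) = 1} = {j. j < n \<and> z i - 1 \<le> j \<and> j < z (Suc i)}"
    using assms(2) by (intro Collect_cong conj_cong refl ribbon_of_eq_1_iff)
  also have "\<dots> = {z i - 1..z (Suc i) - 1}" using z by auto
  finally show "{j. j < n \<and> ribbon_of m n z $$ (i, j) = 1} = {z i - 1..z (Suc i) - 1}" .
  show "z i - 1 \<le> z (Suc i) - 1" using z by (simp add: diff_le_mono)
qed

lemma
  assumes "profile m n z" "i < m"
  shows leftmost_ribbon: "leftmost_one (ribbon_of m n z) i = z i - 1"
    and rightmost_ribbon: "rightmost_one (ribbon_of m n z) i = z (Suc i) - 1"
proof -
  have "dim_col (ribbon_of m n z) = n" by (simp add: ribbon_of_def)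
  then show "leftmost_one (ribbon_of m n z) i = z i - 1"
    "rightmost_one (ribbon_of m n z) i = z (Suc i) - 1"
    unfolding leftmost_one_def rightmost_one_def
    using ribbon_row(2)[OF assms]
    by (simp_all only: ribbon_row(1)[OF assms]) (auto intro!: Min_eqI Max_eqI)
qed

text \<open>The topmost one of column \<open>j\<close> is in the last row of the arranged tableau with a one there.\<close>

lemma topmost_ribbon:
  assumes prof: "profile m n z" and j: "j < n" and m: "1 \<le> m"
  shows "topmost_one (ribbon_of m n z) j < m"
    and "\<And>i. i < m \<Longrightarrow> j < z i \<longleftrightarrow> topmost_one (ribbon_of m n z) j < i"
proof -
  \<comment> \<open>The first row whose right end reaches column \<open>j\<close>. By minimality its
    predecessor does not reach that far, whence \<open>z t \<le> j\<close>.\<close>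
  define t where "t = (LEAST i. j < z (Suc i))"
  have last: "j < z (Suc (m - 1))" using prof j m by (simp add: profile_def)
  then have t: "j < z (Suc t)" "t \<le> m - 1"
    unfolding t_def by (rule LeastI, rule Least_le)
  have t_least: "t \<le> i" if "j < z (Suc i)" for i
    unfolding t_def using that by (rule Least_le)
  have "z t \<le> j"
  proof (cases t)
    case (Suc k)
    then show ?thesis using t_least[of k] by force
  qed (use prof in \<open>simp add: profile_def\<close>)
  have top: "topmost_one (ribbon_of m n z) j = t"
  proof -
    have "{i. i < m \<and> ribbon_of m n z $$ (i, j) = 1} = {i. i < m \<and> z i - 1 \<le> j \<and> j < z (Suc i)}"
      using j by (intro Collect_cong conj_cong refl ribbon_of_eq_1_iff)
    then have "topmost_one (ribbon_of m n z) j = Min {i. i < m \<and> z i - 1 \<le> j \<and> j < z (Suc i)}"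
      unfolding topmost_one_def by (simp add: ribbon_of_def)
    also have "\<dots> = t"
    proof (rule Min_eqI)
      show "t \<in> {i. i < m \<and> z i - 1 \<le> j \<and> j < z (Suc i)}" using t \<open>z t \<le> j\<close> m by auto
    qed (use t_least in simp_all)
    finally show ?thesis .
  qed
  show "topmost_one (ribbon_of m n z) j < m" using top t m by simp
  show "j < z i \<longleftrightarrow> topmost_one (ribbon_of m n z) j < i" if "i < m" for i
  proof
    assume "j < z i"
    then obtain k where "i = Suc k" using prof by (cases i) (auto simp: profile_def)
    then show "topmost_one (ribbon_of m n z) j < i" using t_least[of k] \<open>j < z i\<close> top by simp
  next
    assume "topmost_one (ribbon_of m n z) j < i"
    then show "j < z i" using profile_mono[OF prof, of "Suc t" i] t that top by simp
  qed
qed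

text \<open>The rows \<open>i < m\<close> with \<open>j < z i\<close> are those strictly below the
  topmost one of column \<open>j\<close>. If two tops differed, the larger one would be an index
  \<open>i < m\<close> at which the conditions disagree.\<close>

lemma topmost_ribbon_eq_iff:
  assumes "profile m n z" "j' < n" "j < n" "1 \<le> m"
  shows "topmost_one (ribbon_of m n z) j' = topmost_one (ribbon_of m n z) j \<longleftrightarrow>
    (\<forall>i<m. j' < z i \<longleftrightarrow> j < z i)"
proof -
  note t' = topmost_ribbon[OF assms(1,2,4)] and t = topmost_ribbon[OF assms(1,3,4)]
  show ?thesis
  proof
    assume "\<forall>i<m. j' < z i \<longleftrightarrow> j < z i"
    then have "\<forall>i<m. topmost_one (ribbon_of m n z) j' < i \<longleftrightarrow> topmost_one (ribbon_of m n z) j < i"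
      using t'(2) t(2) by simp
    then show "topmost_one (ribbon_of m n z) j' = topmost_one (ribbon_of m n z) j"
      using t'(1) t(1) by (metis less_irrefl_nat linorder_neqE_nat)
  qed (simp add: t(2) t'(2))
qed

section \<open>Cell counting and the profile of a ribbon\<close>

text \<open>Row \<open>i\<close> has \<open>Suc (R i) - L i\<close> cells. Pairing
  \<open>R i\<close> with \<open>L (Suc i)\<close> leaves the excess overlaps of consecutive rows,
  the last right end and one unit per row. The inequalities keep the subtractions on naturals
  exact.\<close>

lemma sum_telescope_bounds:
  fixes L R :: "nat \<Rightarrow> nat"
  assumes "L 0 = 0" "\<And>i. i \<le> k \<Longrightarrow> L i \<le> R i" "\<And>i. i < k \<Longrightarrow> L (Suc i) \<le> R i"
  shows "(\<Sum>i\<le>k. Suc (R i) - L i) = (\<Sum>i<k. R i - L (Suc i)) + R k + Suc k"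
  using assms(2,3)
proof (induction k)
  case 0
  then show ?case using assms(1) by simp
next
  case (Suc k)
  have "L (Suc k) \<le> R (Suc k)" "L (Suc k) \<le> R k" using Suc.prems by auto
  moreover have "(\<Sum>i\<le>k. Suc (R i) - L i) = (\<Sum>i<k. R i - L (Suc i)) + R k + Suc k"
    using Suc by simp
  ultimately show ?case unfolding sum.atMost_Suc sum.lessThan_Suc by linarith
qed

lemma card_ones_eq_sum:
  fixes P :: "nat mat"
  shows "card {(i, j). i < m \<and> j < n \<and> P $$ (i, j) = 1} =
    (\<Sum>i<m. card {j. j < n \<and> P $$ (i, j) = 1})"
proof -
  have "{(i, j). i < m \<and> j < n \<and> P $$ (i, j) = 1} =
      (SIGMA i:{..<m}. {j. j < n \<and> P $$ (i, j) = 1})"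
    by auto
  then show ?thesis by simp
qed

lemma ribbon_of_in_ribbons:
  assumes m: "1 \<le> m" and n: "1 \<le> n" and prof: "profile m n z"
  shows "ribbon_of m n z \<in> ribbon_parallelogram_polyominoes m n"
proof -
  let ?R = "ribbon_of m n z"
  have z: "z 0 = 0" "1 \<le> z 1" "z m = n" using prof by (auto simp: profile_def)
  have last: "z (m - 1) \<le> n" using profile_le[OF prof, of "m - 1"] by simp
  have "card {(i, j). i < m \<and> j < n \<and> ?R $$ (i, j) = 1} =
      (\<Sum>i<m. Suc (z (Suc i) - 1) - (z i - 1))"
    unfolding card_ones_eq_sum by (intro sum.cong refl, subst ribbon_row(1)[OF prof]) auto
  also have "\<dots> = (\<Sum>i\<le>m - 1. Suc (z (Suc i) - 1) - (z i - 1))"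
    using m by (intro sum.cong) auto
  \<comment> \<open>Each row starts in the column where its predecessor ends, so all excess overlaps
    vanish.\<close>
  also have "\<dots> = (\<Sum>i<m - 1. (z (Suc i) - 1) - (z (Suc i) - 1)) + (z (Suc (m - 1)) - 1) + Suc (m - 1)"
    using m z by (intro sum_telescope_bounds ribbon_row(2)[OF prof]) auto
  also have "\<dots> = m + n - 1" using m n z by simp
  finally have card: "card {(i, j). i < m \<and> j < n \<and> ?R $$ (i, j) = 1} = m + n - 1" .
  have "?R \<in> parallelogram_polyominoes m n"
    unfolding parallelogram_polyominoes_def mem_Collect_eq
  proof (intro conjI allI impI)
    show "?R \<in> tableaux m n" unfolding tableaux_iff by (auto simp: ribbon_of_def)
    show "?R $$ (0, 0) = 1" using m n z by (simp add: ribbon_of_def)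
    show "?R $$ (m - 1, n - 1) = 1" using m n z last by (simp add: ribbon_of_def)
    show "\<exists>j<n. ?R $$ (i, j) = 1" if "i < m" for i
      using ribbon_row[OF prof that] by (metis (mono_tags, lifting) atLeastAtMost_iff mem_Collect_eq order_refl)
    show "?R $$ (i, k) = 1"
      if "i < m" "j < k \<and> k < l \<and> l < n \<and> ?R $$ (i, j) = 1 \<and> ?R $$ (i, l) = 1" for i j k l
    proof -
      have "k < n" "j < n" "l < n" using that by auto
      then have "z i - 1 \<le> j" "l < z (Suc i)" using that ribbon_of_eq_1_iff by blast+
      then show ?thesis using that \<open>k < n\<close> by (subst ribbon_of_eq_1_iff) auto
    qed
    fix i assume "1 \<le> i \<and> i < m"
    then obtain k where "i = Suc k" "Suc k < m" by (cases i) auto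
    then show "leftmost_one ?R (i - 1) \<le> leftmost_one ?R i"
      "leftmost_one ?R i \<le> rightmost_one ?R (i - 1)"
      "rightmost_one ?R (i - 1) \<le> rightmost_one ?R i"
      using ribbon_row(2)[OF prof, of k] ribbon_row(2)[OF prof, of i]
      by (simp_all add: leftmost_ribbon[OF prof] rightmost_ribbon[OF prof])
  qed
  then show ?thesis using card by (simp add: ribbon_parallelogram_polyominoes_def)
qed

text \<open>Contiguity fills the gap between the minimum and the maximum of the nonempty set of
  ones, so a row is determined by its two ends.\<close>

lemma
  assumes "P \<in> parallelogram_polyominoes m n" "i < m"
  shows polyomino_row: "{j. j < n \<and> P $$ (i, j) = 1} = {leftmost_one P i..rightmost_one P i}"
    and polyomino_row_le: "leftmost_one P i \<le> rightmost_one P i"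
    and polyomino_row_less: "rightmost_one P i < n"
proof -
  let ?X = "{j. j < n \<and> P $$ (i, j) = 1}"
  have n: "dim_col P = n" using assms by (auto simp: parallelogram_polyominoes_def tableaux_iff)
  have "\<exists>j<n. P $$ (i, j) = 1" using assms unfolding parallelogram_polyominoes_def by blast
  then have X: "finite ?X" "?X \<noteq> {}" by (simp, blast)
  have contiguous: "k \<in> ?X" if "j < k" "k < l" "j \<in> ?X" "l \<in> ?X" for j k l
  proof -
    have "\<forall>j k l. j < k \<and> k < l \<and> l < n \<and> P $$ (i, j) = 1 \<and> P $$ (i, l) = 1 \<longrightarrow> P $$ (i, k) = 1"
      using assms unfolding parallelogram_polyominoes_def by blast
    then have "P $$ (i, k) = 1" using that by blast
    then show ?thesis using that by simp
  qed
  have L: "leftmost_one P i = Min ?X" and R: "rightmost_one P i = Max ?X"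
    by (simp_all add: leftmost_one_def rightmost_one_def n)
  have mem: "Min ?X \<in> ?X" "Max ?X \<in> ?X" using X by (rule Min_in, rule Max_in)
  show "?X = {leftmost_one P i..rightmost_one P i}"
    unfolding L R
  proof (intro equalityI subsetI)
    fix k assume "k \<in> {Min ?X..Max ?X}"
    then consider "k = Min ?X" | "k = Max ?X" | "Min ?X < k" "k < Max ?X" by force
    then show "k \<in> ?X" using mem contiguous by cases blast+
  next
    fix k assume "k \<in> ?X"
    then show "k \<in> {Min ?X..Max ?X}" using X(1) by (simp add: Min_le Max_ge)
  qed
  show "leftmost_one P i \<le> rightmost_one P i" unfolding L R using X(1) mem(2) by (rule Min_le)
  show "rightmost_one P i < n" unfolding R using mem(2) by blast
qed

text \<open>Given the ends of the first and last rows, the number of cells is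
  \<open>m + n - 1\<close> plus the sum of the excess overlaps. Equality forces each row to end
  where the next begins, and the left ends then give the profile.\<close>

lemma ribbon_imp_ribbon_of:
  assumes m: "1 \<le> m" and n: "1 \<le> n" and P: "P \<in> ribbon_parallelogram_polyominoes m n"
  obtains z where "profile m n z" "P = ribbon_of m n z"
proof -
  let ?L = "leftmost_one P" and ?R = "rightmost_one P"
  from P have poly: "P \<in> parallelogram_polyominoes m n"
    and card: "card {(i, j). i < m \<and> j < n \<and> P $$ (i, j) = 1} = m + n - 1"
    by (auto simp: ribbon_parallelogram_polyominoes_def)
  note row = polyomino_row[OF poly] and row_le = polyomino_row_le[OF poly]
    and row_less = polyomino_row_less[OF poly]
  have corners: "P $$ (0, 0) = 1" "P $$ (m - 1, n - 1) = 1" and tab: "P \<in> tableaux m n"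
    using poly by (auto simp: parallelogram_polyominoes_def)
  have L_le: "?L i \<le> ?L (Suc i)" and overlap: "?L (Suc i) \<le> ?R i" if "Suc i < m" for i
  proof -
    have "1 \<le> Suc i \<and> Suc i < m" using that by simp
    then have "?L (Suc i - 1) \<le> ?L (Suc i) \<and> ?L (Suc i) \<le> ?R (Suc i - 1)"
      using poly unfolding parallelogram_polyominoes_def by blast
    then show "?L i \<le> ?L (Suc i)" "?L (Suc i) \<le> ?R i" by simp_all
  qed
  have "0 \<in> {j. j < n \<and> P $$ (0, j) = 1}" using corners n by simp
  moreover have "0 < m" using m by simp
  ultimately have L0: "?L 0 = 0" by (simp only: row) simp
  have "n - 1 \<in> {j. j < n \<and> P $$ (m - 1, j) = 1}" using corners n by simp
  moreover have "m - 1 < m" using m by simp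
  ultimately have Rm: "?R (m - 1) = n - 1" using row_less[of "m - 1"] by (simp only: row) auto
  have "m + n - 1 = (\<Sum>i<m. Suc (?R i) - ?L i)"
    unfolding card[symmetric] card_ones_eq_sum by (intro sum.cong refl, subst row) auto
  also have "\<dots> = (\<Sum>i\<le>m - 1. Suc (?R i) - ?L i)"
    using m by (intro sum.cong) auto
  also have "\<dots> = (\<Sum>i<m - 1. ?R i - ?L (Suc i)) + ?R (m - 1) + Suc (m - 1)"
    using m L0 overlap row_le by (intro sum_telescope_bounds) auto
  finally have "(\<Sum>i<m - 1. ?R i - ?L (Suc i)) = 0" using Rm m n by linarith
  then have "\<forall>i<m - 1. ?R i - ?L (Suc i) = 0" by (simp add: sum_eq_0_iff Ball_def del: diff_is_0_eq)
  then have R_eq: "?R i = ?L (Suc i)" if "Suc i < m" for i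
    using that overlap[OF that] by (metis Suc_lessD diff_is_0_eq le_antisym less_diff_conv add.commute plus_1_eq_Suc)
  \<comment> \<open>This solves \<open>z i - 1 = leftmost_one P i\<close>. Truncation would admit 0
    or 1 in the top row, where a profile requires 0; the last right end \<open>n - 1\<close>
    requires \<open>z m = n\<close>.\<close>
  define z where "z = (\<lambda>i. if i = 0 then 0 else if i < m then Suc (?L i) else n)"
  have prof: "profile m n z"
    unfolding profile_def
  proof (intro conjI allI impI)
    show "z i \<le> z (Suc i)" if "i < m" for i
    proof (cases "Suc i < m")
      case True
      then show ?thesis using L_le[of i] by (simp add: z_def)
    next
      case False
      have "?L i < n" using row_le[OF that] row_less[OF that] by (rule order_le_less_trans)
      then show ?thesis using False by (simp add: z_def)
    qed
  qed (use m n in \<open>simp_all add: z_def\<close>)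
  moreover have "P = ribbon_of m n z"
  proof (rule eq_matI)
    fix i j assume "i < dim_row (ribbon_of m n z)" "j < dim_col (ribbon_of m n z)"
    then have ij: "i < m" "j < n" by (auto simp: ribbon_of_def)
    have "z i - 1 = ?L i" using ij L0 by (simp add: z_def)
    moreover have "z (Suc i) - 1 = ?R i"
    proof (cases "Suc i < m")
      case False
      then have "i = m - 1" using ij by simp
      then show ?thesis using False Rm by (simp add: z_def)
    qed (simp add: z_def R_eq)
    ultimately have "{j. j < n \<and> P $$ (i, j) = 1} = {j. j < n \<and> ribbon_of m n z $$ (i, j) = 1}"
      using row[OF ij(1)] ribbon_row(1)[OF prof ij(1)] by simp
    then have "P $$ (i, j) = 1 \<longleftrightarrow> ribbon_of m n z $$ (i, j) = 1" using ij by blast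
    moreover have "P $$ (i, j) = 0 \<or> P $$ (i, j) = 1"
      "ribbon_of m n z $$ (i, j) = 0 \<or> ribbon_of m n z $$ (i, j) = 1"
      using tab ij by (auto simp: tableaux_iff ribbon_of_def)
    ultimately show "P $$ (i, j) = ribbon_of m n z $$ (i, j)" by auto
  qed (use tab in \<open>auto simp: tableaux_iff ribbon_of_def\<close>)
  ultimately show ?thesis by (rule that)
qed

text \<open>The right end of row \<open>k\<close> is \<open>z (Suc k) - 1\<close>, and positivity of
  \<open>z (Suc k)\<close> makes the subtraction reversible.\<close>

lemma ribbon_of_inj:
  assumes m: "1 \<le> m" and n: "1 \<le> n" and prof: "profile m n z" "profile m n z'"
    and eq: "ribbon_of m n z = ribbon_of m n z'" and "i \<le> m"
  shows "z i = z' i"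
proof (cases i)
  case 0
  then show ?thesis using prof by (simp add: profile_def)
next
  case (Suc k)
  then have "k < m" using \<open>i \<le> m\<close> by simp
  then have "z (Suc k) - 1 = z' (Suc k) - 1"
    using rightmost_ribbon[OF prof(1)] rightmost_ribbon[OF prof(2)] eq by metis
  moreover have "1 \<le> z (Suc k)" "1 \<le> z' (Suc k)"
    using profile_pos[of m n _ "Suc k"] prof \<open>k < m\<close> by auto
  ultimately show ?thesis using Suc by simp
qed

section \<open>Labelled ribbons are the pairs encoded by arrangements\<close>

lemma arrangement_in_LRib:
  assumes m: "1 \<le> m" and n: "1 \<le> n" and arr: "arrangement m n z \<rho> \<sigma>"
  shows "(ribbon_of m n z, labels_of m n \<rho> \<sigma>) \<in> LRib m n"
proof -
  let ?l = "labels_of m n \<rho> \<sigma>"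
  from arr have prof: "profile m n z" and \<rho>: "\<rho> permutes {..<m}" and \<sigma>: "\<sigma> permutes {..<n}"
    and \<rho>0: "\<rho> 0 = 0"
    and row_ord: "\<And>i' i. i' < i \<Longrightarrow> i < m \<Longrightarrow> z i' = z i \<Longrightarrow> \<rho> i' < \<rho> i"
    and col_ord: "\<And>j' j. j' < j \<Longrightarrow> j < n \<Longrightarrow> \<forall>i<m. j' < z i \<longleftrightarrow> j < z i \<Longrightarrow> \<sigma> j' < \<sigma> j"
    unfolding arrangement_def by blast+
  note rib = ribbon_of_in_ribbons[OF m n prof]
  note row_label = labels_of_nth(1)[of _ m n \<rho> \<sigma>] and col_label = labels_of_nth(2)[of _ n m \<rho> \<sigma>]
  have "(\<lambda>j. m + \<sigma> j) ` {..<n} = (+) m ` (\<sigma> ` {..<n})" by (simp add: image_image)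
  also have "\<dots> = (+) m ` {0..<n}" by (simp add: permutes_image[OF \<sigma>] atLeast0LessThan)
  also have "\<dots> = {m..<m + n}" by (simp add: image_add_atLeastLessThan add.commute)
  finally have col_set: "(\<lambda>j. m + \<sigma> j) ` {..<n} = {m..<m + n}" .
  have "ribbon_of m n z \<in> parallelogram_polyominoes m n"
    using rib by (simp add: ribbon_parallelogram_polyominoes_def)
  moreover have "length ?l = m + n" by (simp add: labels_of_def)
  moreover have "take m ?l \<in> permutations_of_set {0..<m}"
    using permutes_inj_on[OF \<rho>] permutes_image[OF \<rho>]
    by (simp add: labels_of_def permutations_of_set_def distinct_map atLeast0LessThan)
  moreover have "drop m ?l \<in> permutations_of_set {m..<m + n}"
    using permutes_inj[OF \<sigma>] col_set
    by (auto simp: labels_of_def permutations_of_set_def distinct_map atLeast0LessThan inj_on_def inj_def)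
  moreover have "?l ! 0 = 0" using row_label[of 0] m \<rho>0 by simp
  moreover have "?l ! i' < ?l ! i"
    if ii: "i' < i" "i < m" "leftmost_one (ribbon_of m n z) i' = leftmost_one (ribbon_of m n z) i" for i' i
  \<comment> \<open>The top row has \<open>z 0 = 0\<close> but the same left end as a row with
    \<open>z i = 1\<close>. This pair is not a tie in the staircase and is settled by the least
    label \<open>\<rho> 0 = 0\<close>; for the other rows, equal left ends do mean equal profile
    values.\<close>
  proof (cases "i' = 0")
    case True
    have "\<rho> i \<noteq> 0" using \<rho>0 ii True permutes_inj[OF \<rho>] by (metis injD less_irrefl_nat)
    then show ?thesis using True \<rho>0 ii by (simp add: row_label)
  next
    case False
    then have "1 \<le> z i'" "1 \<le> z i" using ii profile_pos[OF prof] by auto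
    moreover have "z i' - 1 = z i - 1" using ii by (simp add: leftmost_ribbon[OF prof])
    ultimately show ?thesis using ii row_ord[of i' i] by (simp add: row_label)
  qed
  moreover have "?l ! (m + j') < ?l ! (m + j)"
    if "j' < j" "j < n" "topmost_one (ribbon_of m n z) j' = topmost_one (ribbon_of m n z) j" for j' j
    using that m col_ord[of j' j] topmost_ribbon_eq_iff[OF prof, of j' j] by (simp add: col_label)
  ultimately show ?thesis
    using rib by (simp add: LRib_def labelled_parallelogram_polyominoes_def)
qed

text \<open>The profile comes from the ribbon and the permutations are read off the label list.
  Equal values of \<open>z\<close> give aligned rows, and unseparated columns have aligned tops, so
  the label conditions of the ribbon supply the tie-breaks.\<close>

lemma LRib_imp_arrangement:
  assumes m: "1 \<le> m" and n: "1 \<le> n" and mem: "(P, l) \<in> LRib m n"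
  obtains z \<rho> \<sigma> where "arrangement m n z \<rho> \<sigma>" "P = ribbon_of m n z" "l = labels_of m n \<rho> \<sigma>"
proof -
  from mem have rib: "P \<in> ribbon_parallelogram_polyominoes m n" and len: "length l = m + n"
    and rows: "take m l \<in> permutations_of_set {0..<m}"
    and cols: "drop m l \<in> permutations_of_set {m..<m + n}" and l0: "l ! 0 = 0"
    and row_ord: "\<And>i' i. i' < i \<Longrightarrow> i < m \<Longrightarrow> leftmost_one P i' = leftmost_one P i \<Longrightarrow> l ! i' < l ! i"
    and col_ord: "\<And>j' j. j' < j \<Longrightarrow> j < n \<Longrightarrow> topmost_one P j' = topmost_one P j
      \<Longrightarrow> l ! (m + j') < l ! (m + j)"
    unfolding LRib_def labelled_parallelogram_polyominoes_def by blast+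
  obtain z where prof: "profile m n z" and P: "P = ribbon_of m n z"
    using ribbon_imp_ribbon_of[OF m n rib] .
  define \<rho> where "\<rho> = (\<lambda>i. if i < m then l ! i else i)"
  \<comment> \<open>Column labels start at \<open>m\<close>, hence the shift; outside the index
    range the value is the identity, as \<open>permutes\<close> demands.\<close>
  define \<sigma> where "\<sigma> = (\<lambda>j. if j < n then l ! (m + j) - m else j)"
  have "bij_betw ((!) (take m l)) {..<m} {0..<m}"
    using rows len by (intro bij_betw_nth) (auto simp: permutations_of_set_def)
  then have "bij_betw \<rho> {..<m} {0..<m}"
    by (rule bij_betw_cong[THEN iffD1, rotated]) (auto simp: \<rho>_def)
  then have \<rho>: "\<rho> permutes {..<m}"
    by (intro bij_imp_permutes) (auto simp: \<rho>_def atLeast0LessThan)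
  have col_bij: "bij_betw ((!) (drop m l)) {..<n} {m..<m + n}"
    using cols len by (intro bij_betw_nth) (auto simp: permutations_of_set_def)
  moreover have "bij_betw (\<lambda>k. k - m) {m..<m + n} {0..<n}"
    by (rule bij_betwI[where g = "\<lambda>k. k + m"]) auto
  ultimately have "bij_betw ((\<lambda>k. k - m) \<circ> (!) (drop m l)) {..<n} {0..<n}"
    by (rule bij_betw_trans)
  then have "bij_betw \<sigma> {..<n} {0..<n}"
    by (rule bij_betw_cong[THEN iffD1, rotated]) (auto simp: \<sigma>_def len)
  then have \<sigma>: "\<sigma> permutes {..<n}"
    by (intro bij_imp_permutes) (auto simp: \<sigma>_def atLeast0LessThan)
  have col_label: "l ! (m + j) = m + \<sigma> j" if "j < n" for j
  proof -
    have "drop m l ! j \<in> {m..<m + n}" using bij_betwE[OF col_bij] that by blast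
    then show ?thesis using that len by (simp add: \<sigma>_def)
  qed
  have "arrangement m n z \<rho> \<sigma>"
    unfolding arrangement_def
  proof (intro conjI allI impI prof \<rho> \<sigma>)
    show "\<rho> 0 = 0" using l0 by (simp add: \<rho>_def)
    show "\<rho> i' < \<rho> i" if "i' < i \<and> i < m \<and> z i' = z i" for i' i
      using that row_ord[of i' i] by (simp add: \<rho>_def P leftmost_ribbon[OF prof])
    show "\<sigma> j' < \<sigma> j" if "j' < j \<and> j < n \<and> (\<forall>i<m. j' < z i \<longleftrightarrow> j < z i)" for j' j
      using that m col_ord[of j' j] topmost_ribbon_eq_iff[OF prof, of j' j] by (simp add: P col_label)
  qed
  moreover have "l = labels_of m n \<rho> \<sigma>"
  proof (rule nth_equalityI)
    fix k assume "k < length l"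
    then have "k < m \<or> k - m < n" using len by linarith
    then show "l ! k = labels_of m n \<rho> \<sigma> ! k"
      using col_label[of "k - m"]
      by (cases "k < m") (simp_all add: labels_of_def nth_append \<rho>_def)
  qed (simp add: labels_of_def len)
  ultimately show ?thesis using P by (intro that)
qed

lemma labels_of_inj:
  assumes "\<rho> permutes {..<m}" "\<rho>' permutes {..<m}" "\<sigma> permutes {..<n}" "\<sigma>' permutes {..<n}"
    and "labels_of m n \<rho> \<sigma> = labels_of m n \<rho>' \<sigma>'"
  shows "\<rho> = \<rho>'" "\<sigma> = \<sigma>'"
proof -
  have "\<rho> i = \<rho>' i" if "i < m" for i
    using labels_of_nth(1)[OF that, of n \<rho> \<sigma>] labels_of_nth(1)[OF that, of n \<rho>' \<sigma>'] assms(5) by simp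
  moreover have "\<sigma> j = \<sigma>' j" if "j < n" for j
    using labels_of_nth(2)[OF that, of m \<rho> \<sigma>] labels_of_nth(2)[OF that, of m \<rho>' \<sigma>'] assms(5) by simp
  ultimately have "\<rho> i = \<rho>' i" "\<sigma> i = \<sigma>' i" for i
    using permutes_not_in[OF assms(1), of i] permutes_not_in[OF assms(2), of i]
      permutes_not_in[OF assms(3), of i] permutes_not_in[OF assms(4), of i]
    by (cases "i < m"; cases "i < n"; simp)+
  then show "\<rho> = \<rho>'" "\<sigma> = \<sigma>'" by (auto intro: ext)
qed

section \<open>The bijection\<close>

theorem theorem3p8:
  fixes m n :: nat
  assumes "m \<ge> 1" and "n \<ge> 1"
  shows "bij_betw (\<phi> m n) (EW m n) (LRib m n)"
  unfolding bij_betw_def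
proof
  note phi = phi_arranged_tableau[OF assms]
  show "inj_on (\<phi> m n) (EW m n)"
  proof (rule inj_onI)
    fix T T' assume "T \<in> EW m n" "T' \<in> EW m n" and eq: "\<phi> m n T = \<phi> m n T'"
    obtain z \<rho> \<sigma> where arr: "arrangement m n z \<rho> \<sigma>" and T: "T = arranged_tableau m n z \<rho> \<sigma>"
      using EW_imp_arranged_tableau[OF assms \<open>T \<in> EW m n\<close>] .
    obtain z' \<rho>' \<sigma>' where arr': "arrangement m n z' \<rho>' \<sigma>'"
      and T': "T' = arranged_tableau m n z' \<rho>' \<sigma>'"
      using EW_imp_arranged_tableau[OF assms \<open>T' \<in> EW m n\<close>] .
    have rib: "ribbon_of m n z = ribbon_of m n z'"
      and lab: "labels_of m n \<rho> \<sigma> = labels_of m n \<rho>' \<sigma>'"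
      using eq by (simp_all add: T T' phi[OF arr] phi[OF arr'])
    have perms: "\<rho> = \<rho>'" "\<sigma> = \<sigma>'"
      using arr arr' labels_of_inj[OF _ _ _ _ lab] by (auto simp: arrangement_def)
    \<comment> \<open>The ribbon determines the profile only up to index \<open>m\<close>. This
      suffices, because the tableau evaluates \<open>z\<close> only at the indices
      \<open>inv \<rho> i < m\<close>.\<close>
    have "inv \<rho> i < m" if "i < m" for i
      using that arr permutes_in_image[OF permutes_inv, of \<rho> "{..<m}" i]
      by (simp add: arrangement_def)
    moreover have "z i = z' i" if "i < m" for i
      using ribbon_of_inj[OF assms _ _ rib] arr arr' that by (simp add: arrangement_def)
    ultimately show "T = T'"
      unfolding T T' arranged_tableau_def perms[symmetric] by (intro cong_mat) auto
  qed
  show "\<phi> m n ` EW m n = LRib m n"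
  proof (intro equalityI subsetI)
    fix x assume "x \<in> \<phi> m n ` EW m n"
    then obtain T where "T \<in> EW m n" and x: "x = \<phi> m n T" by blast
    then obtain z \<rho> \<sigma> where "arrangement m n z \<rho> \<sigma>" "T = arranged_tableau m n z \<rho> \<sigma>"
      using EW_imp_arranged_tableau[OF assms] by metis
    then show "x \<in> LRib m n" using arrangement_in_LRib[OF assms] by (simp add: x phi)
  next
    fix x assume "x \<in> LRib m n"
    then obtain P l where "x = (P, l)" "(P, l) \<in> LRib m n" by (cases x) auto
    then obtain z \<rho> \<sigma> where arr: "arrangement m n z \<rho> \<sigma>"
      and x: "x = (ribbon_of m n z, labels_of m n \<rho> \<sigma>)"
      using LRib_imp_arrangement[OF assms] by metis
    have "x = \<phi> m n (arranged_tableau m n z \<rho> \<sigma>)" by (simp add: x phi[OF arr])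
    then show "x \<in> \<phi> m n ` EW m n" using arranged_tableau_in_EW[OF assms arr] by blast
  qed
qed

end
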